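(* Let $X$ be a Banach space over $K$ ($K=\mathbb{R}$ or $\mathbb{C}$) and let $E$ be a spectral projection on $(m,M]$, $m,M\in\mathbb{R}$. Then $S_{E,C([m,M])}(X)$ is a subspace of $B(X)$. Further, if $E\{(m,\bar\lambda]\}-E\{(m,\underline\lambda]\}\neq0$ for any $\underline\lambda,\bar\lambda\in(m,M]$ with $\underline\lambda<\bar\lambda$, then $S_{E,C([m,M])}(X)$ is a Banach space.
   Context: Spaces are nontrivial. $C([m,M])$ is the Banach space of real-valued continuous functions on $[m,M]$ with the supremum norm. $B(X)$ is the normed space (pointwise operations) of all (possibly nonlinear) maps $F:X\to X$ with $\|F\|_{B(X)}:=\max\left(\sup_{x\ne0}\|F(x)\|_X/\|x\|_X,\ \|F(0)\|_X\right)<\infty$. A spectral projection $E$ on $(m,M]$ is a function from the subsets of $(m,M]$ of the form $\cup_{i=1}^n(a_i,b_i]$, $(a_i,b_i]\subset(m,M]$, into $B(X)$ such that: (a) each $E\{(a_i,b_i]\}$ is a projection operator, i.e. there is a subset $S\subset X$ containing $0$ with $E\{(a_i,b_i]\}(x)=x$ if $x\in S$ and $E\{(a_i,b_i]\}(x)=0$ otherwise; (b) $E(\emptyset)=0$ and $E\{(m,M]\}=I$, the identity map; (c) $E\{(a_1,b_1]\cap(a_2,b_2]\}=E\{(a_1,b_1]\}\circ E\{(a_2,b_2]\}=E\{(a_2,b_2]\}\circ E\{(a_1,b_1]\}$, and if $(a_1,b_1]\cap(a_2,b_2]=\emptyset$ then $E\{(a_1,b_1]\cup(a_2,b_2]\}=E\{(a_1,b_1]\}+E\{(a_2,b_2]\}$.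 For $f\in C([m,M])$, $\int_m^Mf(\lambda)\,dE$ denotes the limit in $\|\cdot\|_{B(X)}$, as $n\to\infty$, of $\sum_{j=1}^nf(\lambda_j)E\{(s_{j-1},s_j]\}$, where $m=s_0<s_1<\dots<s_n=M$, $s_j-s_{j-1}<\epsilon_n$, $\epsilon_n\to0$ and $\lambda_j\in(s_{j-1},s_j]$ (the limit exists and does not depend on the choice of the $\lambda_j$). $S_{E,C([m,M])}(X)$ is the set of all operators $\int_m^Mf(\lambda)\,dE$ with $f\in C([m,M])$.
   Formalization: For complex X, "subspace" and "Banach space" are taken over the real scalars: the functions in C([m,M]) are real-valued, so the set contains I but never iI and is not a complex subspace; for K = R nothing changes. *)

theory Defs
  imports "HOL-Analysis.Analysis"
begin

section \<open>The normed space \<open>B(X)\<close> of bounded, possibly nonlinear, maps\<close>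

text \<open>
  Maps are bounded relative to the norm of the argument; linearity is not required, and
  \<open>F 0\<close> is arbitrary.
\<close>

typedef (overloaded) 'a bmap =
  "{F :: 'a::real_normed_vector \<Rightarrow> 'a. bdd_above ((\<lambda>x. norm (F x) / norm x) ` (- {0}))}"
  morphisms bmap_apply Bmap
  by (rule exI[of _ "\<lambda>x. 0"]) (auto intro!: bdd_aboveI[where M = 0])

lemma bmap_eqI: "(\<And>x. bmap_apply F x = bmap_apply G x) \<Longrightarrow> F = G"
  by (simp add: bmap_apply_inject[symmetric] ext)

lemma bmap_mem_iff:
  "F \<in> {F :: 'a::real_normed_vector \<Rightarrow> 'a. bdd_above ((\<lambda>x. norm (F x) / norm x) ` (- {0}))}
    \<longleftrightarrow> (\<exists>c. \<forall>x. x \<noteq> 0 \<longrightarrow> norm (F x) \<le> c * norm x)"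
  by (auto simp: bdd_above_def divide_simps)

lemma bmap_bound: obtains c where "c \<ge> 0" "\<And>x. x \<noteq> 0 \<Longrightarrow> norm (bmap_apply F x) \<le> c * norm x"
proof -
  obtain c where c: "\<And>x. x \<noteq> 0 \<Longrightarrow> norm (bmap_apply F x) \<le> c * norm x"
    using bmap_apply[of F] unfolding bmap_mem_iff by blast
  have "norm (bmap_apply F x) \<le> max c 0 * norm x" if "x \<noteq> 0" for x
    using c[OF that] mult_right_mono[of c "max c 0" "norm x"] by simp
  then show thesis by (intro that[of "max c 0"]) auto
qed

lemma bmap_apply_Bmap:
  "(\<And>x. x \<noteq> 0 \<Longrightarrow> norm (F x) \<le> c * norm x) \<Longrightarrow> bmap_apply (Bmap F) = F"
  by (rule Bmap_inverse, subst bmap_mem_iff) auto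

instantiation bmap :: (real_normed_vector) real_normed_vector
begin

definition zero_bmap :: "'a bmap" where
  "0 = Bmap (\<lambda>x. 0)"

definition plus_bmap :: "'a bmap \<Rightarrow> 'a bmap \<Rightarrow> 'a bmap" where
  "F + G = Bmap (\<lambda>x. bmap_apply F x + bmap_apply G x)"

definition minus_bmap :: "'a bmap \<Rightarrow> 'a bmap \<Rightarrow> 'a bmap" where
  "F - G = Bmap (\<lambda>x. bmap_apply F x - bmap_apply G x)"

definition uminus_bmap :: "'a bmap \<Rightarrow> 'a bmap" where
  "- F = Bmap (\<lambda>x. - bmap_apply F x)"

definition scaleR_bmap :: "real \<Rightarrow> 'a bmap \<Rightarrow> 'a bmap" where
  "r *\<^sub>R F = Bmap (\<lambda>x. r *\<^sub>R bmap_apply F x)"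

text \<open>
  The supremum in \<^const>\<open>onorm\<close> runs over all \<open>x\<close>; the point \<open>x = 0\<close> contributes
  the value \<open>0\<close>, since division by zero yields zero, and so does not matter as soon as the
  space is nontrivial (see \<open>norm_bmap_eq\<close> below).
\<close>

definition norm_bmap :: "'a bmap \<Rightarrow> real" where
  "norm F = max (onorm (bmap_apply F)) (norm (bmap_apply F 0))"

definition dist_bmap :: "'a bmap \<Rightarrow> 'a bmap \<Rightarrow> real" where
  "dist_bmap F G = norm (F - G)"

definition sgn_bmap :: "'a bmap \<Rightarrow> 'a bmap" where
  "sgn_bmap F = inverse (norm F) *\<^sub>R F"

definition uniformity_bmap :: "('a bmap \<times> 'a bmap) filter" where
  "uniformity_bmap = (INF e\<in>{0<..}. principal {(F, G). dist F G < e})"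

definition open_bmap :: "'a bmap set \<Rightarrow> bool" where
  "open_bmap U \<longleftrightarrow> (\<forall>F\<in>U. eventually (\<lambda>(F', G). F' = F \<longrightarrow> G \<in> U) uniformity)"

lemma apply_zero: "bmap_apply (0 :: 'a bmap) x = 0"
  unfolding zero_bmap_def by (subst bmap_apply_Bmap[where c = 0]) auto

lemma apply_plus: "bmap_apply (F + G :: 'a bmap) x = bmap_apply F x + bmap_apply G x"
proof -
  obtain c where c: "\<And>x. x \<noteq> 0 \<Longrightarrow> norm (bmap_apply F x) \<le> c * norm x" using bmap_bound[of F] by blast
  obtain d where d: "\<And>x. x \<noteq> 0 \<Longrightarrow> norm (bmap_apply G x) \<le> d * norm x" using bmap_bound[of G] by blast
  have "norm (bmap_apply F x + bmap_apply G x) \<le> (c + d) * norm x" if "x \<noteq> 0" for x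
    using norm_triangle_ineq[of "bmap_apply F x" "bmap_apply G x"] c[OF that] d[OF that]
    by (simp add: distrib_right)
  then show ?thesis
    unfolding plus_bmap_def by (subst bmap_apply_Bmap[where c = "c + d"]) auto
qed

lemma apply_scaleR: "bmap_apply (r *\<^sub>R F :: 'a bmap) x = r *\<^sub>R bmap_apply F x"
proof -
  obtain c where c: "\<And>x. x \<noteq> 0 \<Longrightarrow> norm (bmap_apply F x) \<le> c * norm x" using bmap_bound[of F] by blast
  have "norm (r *\<^sub>R bmap_apply F x) \<le> (\<bar>r\<bar> * c) * norm x" if "x \<noteq> 0" for x
    using mult_left_mono[OF c[OF that], of "\<bar>r\<bar>"] by (simp add: mult.assoc)
  then show ?thesis
    unfolding scaleR_bmap_def by (subst bmap_apply_Bmap[where c = "\<bar>r\<bar> * c"]) auto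
qed

lemma apply_uminus: "bmap_apply (- F :: 'a bmap) x = - bmap_apply F x"
proof -
  obtain c where c: "\<And>x. x \<noteq> 0 \<Longrightarrow> norm (bmap_apply F x) \<le> c * norm x" using bmap_bound[of F] by blast
  then show ?thesis
    unfolding uminus_bmap_def by (subst bmap_apply_Bmap[where c = c]) auto
qed

lemma minus_bmap_alt: "F - G = F + (- G :: 'a bmap)"
  unfolding minus_bmap_def plus_bmap_def by (simp add: apply_uminus)

lemma apply_minus: "bmap_apply (F - G :: 'a bmap) x = bmap_apply F x - bmap_apply G x"
  by (simp add: minus_bmap_alt apply_plus apply_uminus)

lemma norm_bmap_le_iff:
  assumes "c \<ge> 0"
  shows "norm (F :: 'a bmap) \<le> c \<longleftrightarrow>
    norm (bmap_apply F 0) \<le> c \<and> (\<forall>x. x \<noteq> 0 \<longrightarrow> norm (bmap_apply F x) \<le> c * norm x)"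
proof -
  obtain d where d: "d \<ge> 0" "\<And>x. x \<noteq> 0 \<Longrightarrow> norm (bmap_apply F x) \<le> d * norm x"
    using bmap_bound[of F] by blast
  have "norm (bmap_apply F x) / norm x \<le> d" for x
    using d by (cases "x = 0") (auto simp: divide_simps)
  then have bdd: "bdd_above (range (\<lambda>x. norm (bmap_apply F x) / norm x))"
    by (auto intro!: bdd_aboveI[where M = d])
  have "onorm (bmap_apply F) \<le> c \<longleftrightarrow> (\<forall>x. norm (bmap_apply F x) / norm x \<le> c)"
    unfolding onorm_def by (subst cSUP_le_iff) (use bdd in auto)
  also have "\<dots> \<longleftrightarrow> (\<forall>x. x \<noteq> 0 \<longrightarrow> norm (bmap_apply F x) \<le> c * norm x)"
    using assms by (auto simp: divide_simps)
  finally show ?thesis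
    by (auto simp: norm_bmap_def)
qed

lemma norm_bmap_nonneg: "norm (F :: 'a bmap) \<ge> 0"
  by (simp add: norm_bmap_def le_max_iff_disj)

lemma norm_bmap_zero_bound: "norm (bmap_apply F 0) \<le> norm (F :: 'a bmap)"
  by (simp add: norm_bmap_def)

lemma norm_bmap_bound: "x \<noteq> 0 \<Longrightarrow> norm (bmap_apply F x) \<le> norm (F :: 'a bmap) * norm x"
  using norm_bmap_le_iff[OF norm_bmap_nonneg, of F F] by auto

instance
proof
  fix F G H :: "'a bmap" and r s :: real
  show "dist F G = norm (F - G)" by (rule dist_bmap_def)
  show "sgn F = inverse (norm F) *\<^sub>R F" by (rule sgn_bmap_def)
  show "uniformity = (INF e\<in>{0<..}. principal {(F, G::'a bmap). dist F G < e})"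
    by (rule uniformity_bmap_def)
  show "open U \<longleftrightarrow> (\<forall>F\<in>U. eventually (\<lambda>(F', G). F' = F \<longrightarrow> G \<in> U) uniformity)"
    for U :: "'a bmap set"
    by (rule open_bmap_def)
  show "F + G + H = F + (G + H)" "F + G = G + F" "0 + F = F" "- F + F = 0" "F - G = F + - G"
    "r *\<^sub>R (F + G) = r *\<^sub>R F + r *\<^sub>R G" "(r + s) *\<^sub>R F = r *\<^sub>R F + s *\<^sub>R F"
    "r *\<^sub>R s *\<^sub>R F = (r * s) *\<^sub>R F" "1 *\<^sub>R F = F"
    by (auto intro!: bmap_eqI
        simp: apply_plus apply_zero apply_uminus apply_minus apply_scaleR algebra_simps)
  show "norm F = 0 \<longleftrightarrow> F = 0"
  proof
    assume "norm F = 0"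
    then have "norm F \<le> 0" by simp
    then have "bmap_apply F x = 0" for x
      using norm_bmap_le_iff[of 0 F] by (cases "x = 0") auto
    then show "F = 0" by (intro bmap_eqI) (simp add: apply_zero)
  next
    assume "F = 0"
    then have "norm F \<le> 0" using norm_bmap_le_iff[of 0 F] by (simp add: apply_zero)
    then show "norm F = 0" using norm_bmap_nonneg[of F] by simp
  qed
  show "norm (F + G) \<le> norm F + norm G"
  proof (subst norm_bmap_le_iff, goal_cases)
    case 1
    show ?case using norm_bmap_nonneg[of F] norm_bmap_nonneg[of G] by simp
  next
    case 2
    show ?case
    proof (intro conjI allI impI)
      show "norm (bmap_apply (F + G) 0) \<le> norm F + norm G"
        unfolding apply_plus
        by (intro norm_triangle_mono norm_bmap_zero_bound)
      show "norm (bmap_apply (F + G) x) \<le> (norm F + norm G) * norm x" if "x \<noteq> 0" for x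
        unfolding apply_plus distrib_right
        by (intro norm_triangle_mono norm_bmap_bound that)
    qed
  qed
  have scale_le: "norm (t *\<^sub>R T) \<le> \<bar>t\<bar> * norm T" for t and T :: "'a bmap"
  proof (subst norm_bmap_le_iff, goal_cases)
    case 1
    show ?case using norm_bmap_nonneg[of T] by simp
  next
    case 2
    show ?case
      using norm_bmap_bound[of _ T] norm_bmap_zero_bound[of T]
      by (auto simp: apply_scaleR mult.assoc intro!: mult_left_mono)
  qed
  show "norm (r *\<^sub>R F) = \<bar>r\<bar> * norm F"
  proof (cases "r = 0")
    case True
    then show ?thesis using scale_le[of r F] norm_bmap_nonneg[of "r *\<^sub>R F"] by simp
  next
    case False
    have "(1 / r) *\<^sub>R (r *\<^sub>R F) = F"
      using False by (intro bmap_eqI) (simp add: apply_scaleR)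
    then have "norm F \<le> \<bar>1 / r\<bar> * norm (r *\<^sub>R F)"
      using scale_le[of "1 / r" "r *\<^sub>R F"] by simp
    then have "\<bar>r\<bar> * norm F \<le> norm (r *\<^sub>R F)"
      using False by (simp add: field_simps)
    then show ?thesis using scale_le[of r F] by simp
  qed
qed

end

lemma norm_bmap_eq:
  fixes F :: "'a::real_normed_vector bmap"
  assumes "\<exists>x::'a. x \<noteq> 0"
  shows "norm F =
    max (SUP x\<in>- {0}. norm (bmap_apply F x) / norm x) (norm (bmap_apply F 0))"
proof -
  let ?q = "\<lambda>x. norm (bmap_apply F x) / norm x"
  have bdd: "bdd_above (?q ` (- {0}))" using bmap_apply[of F] by simp
  have ne: "- {0 :: 'a} \<noteq> {}" using assms by auto
  have "range ?q = insert 0 (?q ` (- {0}))"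
    by (auto simp: image_iff)
  then have "onorm (bmap_apply F) = Sup (insert 0 (?q ` (- {0})))"
    by (simp add: onorm_def)
  also have "\<dots> = sup 0 (SUP x\<in>- {0}. ?q x)"
    by (rule cSup_insert) (use ne bdd in auto)
  also have "\<dots> = (SUP x\<in>- {0}. ?q x)"
  proof -
    obtain x :: 'a where "x \<noteq> 0" using assms by auto
    then have "?q x \<le> (SUP x\<in>- {0}. ?q x)" by (intro cSUP_upper bdd) auto
    moreover have "0 \<le> ?q x" by simp
    ultimately show ?thesis by (intro sup_absorb2) (rule order_trans)
  qed
  finally show ?thesis by (simp add: norm_bmap_def)
qed


section \<open>Spectral projections and integrals\<close>

definition projection_map :: "('a::real_normed_vector \<Rightarrow> 'a) \<Rightarrow> bool" where
  "projection_map P \<longleftrightarrow> (\<exists>S. 0 \<in> S \<and> (\<forall>x. P x = (if x \<in> S then x else 0)))"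

text \<open>
  Only the values of \<open>E\<close> at finite unions of intervals \<open>(a, b] \<subseteq> (m, M]\<close> matter; the
  intervals may be empty. The composition is taken on the underlying functions because
  \<open>B(X)\<close> is not closed under composition: a map in \<open>B(X)\<close> need not fix \<open>0\<close>.
\<close>

definition spectral_projection ::
    "real \<Rightarrow> real \<Rightarrow> (real set \<Rightarrow> 'a::real_normed_vector bmap) \<Rightarrow> bool" where
  "spectral_projection m M E \<longleftrightarrow>
    (\<forall>a b. {a<..b} \<subseteq> {m<..M} \<longrightarrow> projection_map (bmap_apply (E {a<..b}))) \<and>
    E {} = 0 \<and> bmap_apply (E {m<..M}) = id \<and>
    (\<forall>a b c d. {a<..b} \<subseteq> {m<..M} \<and> {c<..d} \<subseteq> {m<..M} \<longrightarrow>
      bmap_apply (E ({a<..b} \<inter> {c<..d})) = bmap_apply (E {a<..b}) \<circ> bmap_apply (E {c<..d}) \<and>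
      bmap_apply (E ({a<..b} \<inter> {c<..d})) = bmap_apply (E {c<..d}) \<circ> bmap_apply (E {a<..b}) \<and>
      ({a<..b} \<inter> {c<..d} = {} \<longrightarrow> E ({a<..b} \<union> {c<..d}) = E {a<..b} + E {c<..d}))"

text \<open>
  The \<open>n\<close>-th partition \<open>m = s n 0 < \<dots> < s n n = M\<close> has \<open>n\<close> pieces and tags \<open>l n 1, \<dots>, l n n\<close>.
\<close>

definition has_spectral_integral ::
    "real \<Rightarrow> real \<Rightarrow> (real set \<Rightarrow> 'a::real_normed_vector bmap) \<Rightarrow> (real \<Rightarrow> real)
      \<Rightarrow> 'a bmap \<Rightarrow> bool" where
  "has_spectral_integral m M E f T \<longleftrightarrow>
    (\<forall>(s :: nat \<Rightarrow> nat \<Rightarrow> real) (l :: nat \<Rightarrow> nat \<Rightarrow> real) (\<epsilon> :: nat \<Rightarrow> real).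
      \<epsilon> \<longlonglongrightarrow> 0 \<and>
      (\<forall>n\<ge>1. s n 0 = m \<and> s n n = M \<and>
        (\<forall>j\<in>{1..n}. s n (j - 1) < s n j \<and> s n j - s n (j - 1) < \<epsilon> n \<and>
          l n j \<in> {s n (j - 1)<..s n j})) \<longrightarrow>
      (\<lambda>n. \<Sum>j=1..n. f (l n j) *\<^sub>R E {s n (j - 1)<..s n j}) \<longlonglongrightarrow> T)"

definition spectral_integral ::
    "real \<Rightarrow> real \<Rightarrow> (real set \<Rightarrow> 'a::real_normed_vector bmap) \<Rightarrow> (real \<Rightarrow> real) \<Rightarrow> 'a bmap" where
  "spectral_integral m M E f = (THE T. has_spectral_integral m M E f T)"

text \<open>
  The integrands are real-valued whatever the scalar field of \<open>X\<close> is, so the set below is closed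
  under multiplication by real scalars only: for \<open>X = \<complex>\<close> and
  \<open>E A = (if M \<in> A then I else 0)\<close> it is \<open>\<real> I\<close>.
\<close>

definition spectral_operators ::
    "real \<Rightarrow> real \<Rightarrow> (real set \<Rightarrow> 'a::real_normed_vector bmap) \<Rightarrow> 'a bmap set" where
  "spectral_operators m M E = spectral_integral m M E ` {f. continuous_on {m..M} f}"

text \<open>
  A type of class \<^class>\<open>banach\<close> carries a real scalar multiplication. The following predicate says
  that it is the restriction of a scalar multiplication by \<open>K\<close>. The class
  \<^class>\<open>real_normed_field\<close> (fields over the reals with multiplicative norm) has \<open>K = \<real>\<close> and
  \<open>K = \<complex>\<close> as its only instances up to isometric isomorphism, by the Gelfand--Mazur theorem.
\<close>

definition normed_space_over ::
    "('k::real_normed_field \<Rightarrow> 'a::real_normed_vector \<Rightarrow> 'a) \<Rightarrow> bool" where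
  "normed_space_over smul \<longleftrightarrow>
    vector_space smul \<and>
    (\<forall>r x. smul (of_real r) x = r *\<^sub>R x) \<and>
    (\<forall>a x. norm (smul a x) = norm a * norm x)"

end

theory Submission
  imports Defs
begin

text \<open>
  For \<open>x \<noteq> 0\<close> the projections \<open>E (m, t]\<close> either fix \<open>x\<close> or send it to \<open>0\<close>, and they fix it from
  some threshold \<open>\<mu> x \<in> [m, M]\<close> on. An interval of a partition whose projection fixes \<open>x\<close> has
  \<open>\<mu> x\<close> in its closure, so uniform continuity of \<open>f\<close> gives that the integral of \<open>f\<close> is the
  multiplication operator \<open>x \<mapsto> f (\<mu> x) x\<close>, which is linear in \<open>f\<close>. Its norm is the supremum
  of \<open>\<bar>f\<bar>\<close> over the values of \<open>\<mu>\<close> at nonzero vectors. If \<open>E (m, hi] \<noteq> E (m, lo]\<close> for \<open>lo < hi\<close>, then these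
  values are dense in \<open>[m, M]\<close>, so that the integral is an isometry on \<open>C [m, M]\<close> and its range
  inherits completeness.
\<close>

text \<open>No one-sided continuity of \<open>E\<close> is assumed, so the infimum need not be
  attained, and it can be \<open>m\<close>, which lies outside \<open>(m, M]\<close>.\<close>

definition spectral_threshold ::
    "real \<Rightarrow> real \<Rightarrow> (real set \<Rightarrow> 'a::real_normed_vector bmap) \<Rightarrow> 'a \<Rightarrow> real" where
  "spectral_threshold m M E x = Inf {t \<in> {m..M}. bmap_apply (E {m<..t}) x = x}"

definition multiplication_map ::
    "real \<Rightarrow> real \<Rightarrow> (real set \<Rightarrow> 'a::real_normed_vector bmap) \<Rightarrow> (real \<Rightarrow> real) \<Rightarrow> 'a bmap" where
  "multiplication_map m M E f = Bmap (\<lambda>x. f (spectral_threshold m M E x) *\<^sub>R x)"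

lemma continuous_on_Icc_bound:
  fixes f :: "real \<Rightarrow> real"
  assumes "continuous_on {m..M} f"
  obtains c where "\<And>t. t \<in> {m..M} \<Longrightarrow> \<bar>f t\<bar> \<le> c"
proof -
  have "bounded (f ` {m..M})"
    using assms by (intro compact_imp_bounded compact_continuous_image) auto
  then show thesis
    using that unfolding bounded_iff real_norm_def by blast
qed

locale nontrivial_spectral_projection =
  fixes m M :: real and E :: "real set \<Rightarrow> 'a::real_normed_vector bmap"
  assumes nontrivial: "\<exists>x::'a. x \<noteq> 0"
    and spectral: "spectral_projection m M E"
begin

abbreviation \<mu> :: "'a \<Rightarrow> real" where
  "\<mu> \<equiv> spectral_threshold m M E"

section \<open>Projections of intervals\<close>

lemma E_empty: "E {} = 0"
  using spectral by (simp add: spectral_projection_def)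

lemma apply_E_full: "bmap_apply (E {m<..M}) x = x"
  using spectral by (simp add: spectral_projection_def)

text \<open>Otherwise \<open>(m, M]\<close> is empty and its projection is both 0 and the identity,
  which a nontrivial space excludes.\<close>

lemma less: "m < M"
proof (rule ccontr)
  assume "\<not> m < M"
  then have "bmap_apply (E {m<..M}) x = 0" for x
    by (simp add: E_empty apply_zero)
  then show False
    using nontrivial apply_E_full by metis
qed

lemma apply_E_Ioc_cases:
  assumes "m \<le> a" "b \<le> M"
  shows "bmap_apply (E {a<..b}) x = x \<or> bmap_apply (E {a<..b}) x = 0"
proof -
  have "{a<..b} \<subseteq> {m<..M}"
    using assms by auto
  then have "projection_map (bmap_apply (E {a<..b}))"
    using spectral unfolding spectral_projection_def by blast
  then show ?thesis
    by (auto simp: projection_map_def)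
qed

lemma apply_E_at_zero: "m \<le> a \<Longrightarrow> b \<le> M \<Longrightarrow> bmap_apply (E {a<..b}) 0 = 0"
  using apply_E_Ioc_cases[of a b 0] by auto

lemma E_Ioc_eq_diff:
  assumes "m \<le> a" "a \<le> b" "b \<le> M"
  shows "E {a<..b} = E {m<..b} - E {m<..a}"
proof -
  have "{m<..a} \<subseteq> {m<..M}" "{a<..b} \<subseteq> {m<..M}" "{m<..a} \<inter> {a<..b} = {}"
    using assms by auto
  then have "E ({m<..a} \<union> {a<..b}) = E {m<..a} + E {a<..b}"
    using spectral unfolding spectral_projection_def by blast
  moreover have "{m<..a} \<union> {a<..b} = {m<..b}"
    using assms by auto
  ultimately show ?thesis
    by simp
qed

text \<open>As \<open>(m, a]\<close> lies in \<open>(m, b]\<close>, the projection of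
  \<open>(m, a]\<close> factors through that of \<open>(m, b]\<close>. If the latter sent
  \<open>x\<close> to 0, so would the former.\<close>

lemma apply_E_fixed_mono:
  assumes "m \<le> a" "a \<le> b" "b \<le> M" "bmap_apply (E {m<..a}) x = x"
  shows "bmap_apply (E {m<..b}) x = x"
proof (rule ccontr)
  assume "\<not> ?thesis"
  then have zero: "bmap_apply (E {m<..b}) x = 0" "x \<noteq> 0"
    using apply_E_Ioc_cases[of m b x] apply_E_at_zero[of m b] assms by auto
  have "{m<..a} \<subseteq> {m<..M}" "{m<..b} \<subseteq> {m<..M}"
    using assms by auto
  then have "bmap_apply (E ({m<..a} \<inter> {m<..b})) = bmap_apply (E {m<..a}) \<circ> bmap_apply (E {m<..b})"
    using spectral unfolding spectral_projection_def by blast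
  moreover have "{m<..a} \<inter> {m<..b} = {m<..a}"
    using assms by auto
  ultimately have "bmap_apply (E {m<..a}) x = bmap_apply (E {m<..a}) (bmap_apply (E {m<..b}) x)"
    by (metis comp_apply)
  then show False
    using zero assms apply_E_at_zero[of m a] by auto
qed

section \<open>The threshold of a vector\<close>

lemma threshold_le:
  assumes "t \<in> {m..M}" "bmap_apply (E {m<..t}) x = x"
  shows "\<mu> x \<le> t"
  unfolding spectral_threshold_def
  by (rule cInf_lower) (use assms in \<open>auto intro!: bdd_belowI[where m = m]\<close>)

lemma le_threshold:
  assumes "t \<in> {m..M}" "bmap_apply (E {m<..t}) x \<noteq> x"
  shows "t \<le> \<mu> x"
  unfolding spectral_threshold_def
proof (rule cInf_greatest)
  show "{t \<in> {m..M}. bmap_apply (E {m<..t}) x = x} \<noteq> {}"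
    using less apply_E_full[of x] by (auto intro!: exI[of _ M])
  show "t \<le> u" if "u \<in> {t \<in> {m..M}. bmap_apply (E {m<..t}) x = x}" for u
    using that assms apply_E_fixed_mono[of u t x] by fastforce
qed

lemma threshold_mem: "\<mu> x \<in> {m..M}"
proof -
  have "\<mu> x \<le> M"
    using less apply_E_full by (intro threshold_le) auto
  moreover have "m \<le> \<mu> x"
  \<comment> \<open>\<open>le_threshold\<close> at \<open>t = m\<close> needs a vector that
    \<open>E {} = 0\<close> moves, so the zero vector is treated separately.\<close>
  proof (cases "x = 0")
    case True
    then show ?thesis
      unfolding spectral_threshold_def using less apply_E_full[of x]
      by (intro cInf_greatest) (auto intro!: exI[of _ M])
  next
    case False
    then show ?thesis
      using less by (intro le_threshold) (auto simp: E_empty apply_zero)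
  qed
  ultimately show ?thesis
    by simp
qed

text \<open>\<open>E (a, b]\<close> is the increment of \<open>t \<mapsto> E (m, t]\<close>, so
  \<open>E (m, b]\<close> fixes \<open>x\<close> and \<open>E (m, a]\<close> does not. The left
  endpoint has to be included: the threshold may be \<open>a\<close> without being attained.\<close>

lemma threshold_mem_Icc:
  assumes "m \<le> a" "a \<le> b" "b \<le> M" "bmap_apply (E {a<..b}) x \<noteq> 0"
  shows "\<mu> x \<in> {a..b}"
proof -
  have *: "bmap_apply (E {m<..b}) x - bmap_apply (E {m<..a}) x \<noteq> 0"
    using assms by (simp add: E_Ioc_eq_diff[of a b] apply_minus)
  have "bmap_apply (E {m<..b}) x = x"
  proof (rule ccontr)
    assume not_fixed: "bmap_apply (E {m<..b}) x \<noteq> x"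
    then have "bmap_apply (E {m<..b}) x = 0" "bmap_apply (E {m<..a}) x = 0"
      using assms apply_E_Ioc_cases[of m b x] apply_E_Ioc_cases[of m a x]
        apply_E_fixed_mono[of a b x] by auto
    then show False
      using * by simp
  qed
  moreover from this have "bmap_apply (E {m<..a}) x \<noteq> x"
    using * by auto
  ultimately show ?thesis
    using assms by (auto intro!: threshold_le le_threshold)
qed

section \<open>Multiplication operators\<close>

lemma apply_multiplication_map:
  assumes "continuous_on {m..M} f"
  shows "bmap_apply (multiplication_map m M E f) x = f (\<mu> x) *\<^sub>R x"
proof -
  obtain c where "\<And>t. t \<in> {m..M} \<Longrightarrow> \<bar>f t\<bar> \<le> c"
    using continuous_on_Icc_bound[OF assms] by metis
  then have "norm (f (\<mu> y) *\<^sub>R y) \<le> c * norm y" for y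
    using threshold_mem[of y] by (simp add: mult_right_mono)
  then show ?thesis
    unfolding multiplication_map_def by (subst bmap_apply_Bmap[where c = c]) auto
qed

lemma multiplication_map_diff:
  assumes "continuous_on {m..M} f" "continuous_on {m..M} g"
  shows "multiplication_map m M E f - multiplication_map m M E g =
    multiplication_map m M E (\<lambda>t. f t - g t)"
  using assms
  by (intro bmap_eqI)
    (simp add: apply_minus apply_multiplication_map continuous_on_diff scaleR_left_diff_distrib)

lemma norm_multiplication_map_le:
  assumes "continuous_on {m..M} f" "\<And>t. t \<in> {m..M} \<Longrightarrow> \<bar>f t\<bar> \<le> c"
  shows "norm (multiplication_map m M E f) \<le> c"
proof -
  have "0 \<le> c"
    using assms(2)[of m] less by auto
  then show ?thesis
    using assms threshold_mem
    by (auto simp: norm_bmap_le_iff apply_multiplication_map intro!: mult_right_mono)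
qed

section \<open>Riemann sums and the integral\<close>

lemma partition_mono:
  fixes s :: "nat \<Rightarrow> real"
  assumes "\<And>j. j \<in> {1..n} \<Longrightarrow> s (j - 1) < s j" "i \<le> j" "j \<le> n"
  shows "s i \<le> s j"
  using assms(2,3)
proof (induction j rule: dec_induct)
  case (step j)
  then show ?case
    using assms(1)[of "Suc j"] by simp
qed simp

text \<open>Applied to \<open>x \<noteq> 0\<close>, the sum multiplies \<open>x\<close> by a
  weighted mean of the values \<open>f (l j)\<close>. The weights are carried by intervals whose
  closure contains the threshold of \<open>x\<close>, hence \<open>close\<close> is stated for
  closed intervals. The relative error does not depend on \<open>x\<close>, so it bounds the
  norm.\<close>

lemma norm_Riemann_sum_diff_le:
  fixes s l :: "nat \<Rightarrow> real"
  assumes f: "continuous_on {m..M} f"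
    and s: "s 0 = m" "s n = M" "\<And>j. j \<in> {1..n} \<Longrightarrow> s (j - 1) < s j"
    and close: "\<And>j t. j \<in> {1..n} \<Longrightarrow> t \<in> {s (j - 1)..s j} \<Longrightarrow> \<bar>f (l j) - f t\<bar> \<le> e"
    and "0 \<le> e"
  shows "norm ((\<Sum>j=1..n. f (l j) *\<^sub>R E {s (j - 1)<..s j}) - multiplication_map m M E f) \<le> e"
proof -
  let ?D = "(\<Sum>j=1..n. f (l j) *\<^sub>R E {s (j - 1)<..s j}) - multiplication_map m M E f"
  have mem: "m \<le> s (j - 1)" "s (j - 1) \<le> s j" "s j \<le> M" if "j \<in> {1..n}" for j
    using partition_mono[of n s 0 "j - 1"] partition_mono[of n s j n] s that
    by (auto simp: less_imp_le)
  have apply_sum: "bmap_apply (sum F A) x = (\<Sum>j\<in>A. bmap_apply (F j) x)"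
    for F :: "nat \<Rightarrow> 'a bmap" and A x
    by (induction A rule: infinite_finite_induct) (simp_all add: apply_zero apply_plus)
  have telescope: "(\<Sum>j=1..n. g (s j) - g (s (j - 1))) = g (s n) - g (s 0)"
    for g :: "real \<Rightarrow> 'b::ab_group_add"
    using sum_telescope''[of 0 n "\<lambda>j. g (s j)"] by simp
  have bound: "norm (bmap_apply ?D x) \<le> e * norm x" for x
  proof (cases "x = 0")
    \<comment> \<open>The norm of \<open>B(X)\<close> also counts the value at 0; here all terms
      vanish.\<close>
    case True
    have "bmap_apply (E {s (j - 1)<..s j}) 0 = 0" if "j \<in> {1..n}" for j
      using mem[OF that] by (intro apply_E_at_zero) auto
    then show ?thesis
      using True f by (simp add: apply_minus apply_sum apply_scaleR apply_multiplication_map)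
  next
    case False
    \<comment> \<open>The increments of this 0-1 valued step function are the weights.\<close>
    define h :: "real \<Rightarrow> real" where "h t = (if bmap_apply (E {m<..t}) x = x then 1 else 0)" for t
    have E_h: "bmap_apply (E {m<..t}) x = h t *\<^sub>R x" if "t \<le> M" for t
      using apply_E_Ioc_cases[of m t x] that by (auto simp: h_def)
    have E_j: "bmap_apply (E {s (j - 1)<..s j}) x = (h (s j) - h (s (j - 1))) *\<^sub>R x"
      if "j \<in> {1..n}" for j
      unfolding E_Ioc_eq_diff[OF mem[OF that]] using mem[OF that]
      by (simp add: apply_minus E_h scaleR_left_diff_distrib)
    have h_mono: "h (s (j - 1)) \<le> h (s j)" if "j \<in> {1..n}" for j
      using mem[OF that] apply_E_fixed_mono[of "s (j - 1)" "s j" x] by (auto simp: h_def)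
    \<comment> \<open>The sum telescopes to \<open>h M - h m\<close>; \<open>h m = 0\<close> because
      \<open>E {} = 0\<close> does not fix \<open>x \<noteq> 0\<close>.\<close>
    have one: "(\<Sum>j=1..n. h (s j) - h (s (j - 1))) = 1"
      using False s by (subst telescope) (simp add: h_def apply_E_full E_empty apply_zero)
    have term_le: "\<bar>f (l j) - f (\<mu> x)\<bar> * (h (s j) - h (s (j - 1))) \<le> e * (h (s j) - h (s (j - 1)))"
      if "j \<in> {1..n}" for j
    proof (cases "h (s j) = h (s (j - 1))")
      case ne: False
      then have "\<mu> x \<in> {s (j - 1)..s j}"
        using mem[OF that] E_j[OF that] False by (intro threshold_mem_Icc) auto
      then show ?thesis
        using close[OF that] h_mono[OF that] by (intro mult_right_mono) auto
    qed simp
    \<comment> \<open>The factor 1 is kept so that \<open>one\<close> can turn it into the sum of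
      the weights.\<close>
    have "bmap_apply ?D x =
      (\<Sum>j=1..n. (f (l j) * (h (s j) - h (s (j - 1)))) *\<^sub>R x) - (f (\<mu> x) * 1) *\<^sub>R x"
      using f E_j by (simp add: apply_minus apply_sum apply_scaleR apply_multiplication_map)
    also have "\<dots> = (\<Sum>j=1..n. (f (l j) - f (\<mu> x)) * (h (s j) - h (s (j - 1)))) *\<^sub>R x"
      unfolding one[symmetric]
      by (simp add: sum_distrib_left left_diff_distrib right_diff_distrib sum_subtractf
          scaleR_left_diff_distrib flip: scaleR_sum_left)
    also have "norm \<dots> \<le> (e * (\<Sum>j=1..n. h (s j) - h (s (j - 1)))) * norm x"
      unfolding norm_scaleR sum_distrib_left real_norm_def
    proof (rule mult_right_mono[OF order_trans[OF sum_abs sum_mono]])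
      show "\<bar>(f (l j) - f (\<mu> x)) * (h (s j) - h (s (j - 1)))\<bar> \<le> e * (h (s j) - h (s (j - 1)))"
        if "j \<in> {1..n}" for j
        using term_le[OF that] h_mono[OF that] by (simp add: abs_mult)
    qed simp
    finally show ?thesis
      unfolding one by simp
  qed
  from bound[of 0] bound \<open>0 \<le> e\<close> show ?thesis
    by (subst norm_bmap_le_iff) auto
qed

lemma has_spectral_integral_multiplication_map:
  assumes f: "continuous_on {m..M} f"
  shows "has_spectral_integral m M E f (multiplication_map m M E f)"
  unfolding has_spectral_integral_def
proof (intro allI impI, elim conjE)
  fix s l :: "nat \<Rightarrow> nat \<Rightarrow> real" and \<epsilon> :: "nat \<Rightarrow> real"
  assume \<epsilon>: "\<epsilon> \<longlonglongrightarrow> 0"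
    and part: "\<forall>n\<ge>1. s n 0 = m \<and> s n n = M \<and>
        (\<forall>j\<in>{1..n}. s n (j - 1) < s n j \<and> s n j - s n (j - 1) < \<epsilon> n \<and>
          l n j \<in> {s n (j - 1)<..s n j})"
  have uc: "uniformly_continuous_on {m..M} f"
    using f by (intro compact_uniformly_continuous) auto
  show "(\<lambda>n. \<Sum>j=1..n. f (l n j) *\<^sub>R E {s n (j - 1)<..s n j})
    \<longlonglongrightarrow> multiplication_map m M E f"
  proof (rule LIMSEQ_I)
    fix r :: real
    assume "0 < r"
    then obtain d where d: "d > 0"
      "\<And>t u. t \<in> {m..M} \<Longrightarrow> u \<in> {m..M} \<Longrightarrow> dist u t < d \<Longrightarrow> dist (f u) (f t) < r / 2"
      using uc unfolding uniformly_continuous_on_def by (metis half_gt_zero)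
    obtain N where N: "\<And>n. n \<ge> N \<Longrightarrow> norm (\<epsilon> n - 0) < d"
      using LIMSEQ_D[OF \<epsilon> d(1)] by blast
    show "\<exists>N. \<forall>n\<ge>N. norm ((\<Sum>j=1..n. f (l n j) *\<^sub>R E {s n (j - 1)<..s n j}) -
      multiplication_map m M E f) < r"
    proof (intro exI allI impI)
      fix n
      \<comment> \<open>The conditions on the partitions start at \<open>n = 1\<close>.\<close>
      assume n: "n \<ge> max N 1"
      have s: "s n 0 = m" "s n n = M" "\<And>j. j \<in> {1..n} \<Longrightarrow> s n (j - 1) < s n j"
        and fine: "\<And>j. j \<in> {1..n} \<Longrightarrow> s n j - s n (j - 1) < \<epsilon> n \<and> l n j \<in> {s n (j - 1)<..s n j}"
        using part n by auto
      have "norm ((\<Sum>j=1..n. f (l n j) *\<^sub>R E {s n (j - 1)<..s n j}) -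
        multiplication_map m M E f) \<le> r / 2"
      proof (rule norm_Riemann_sum_diff_le[OF f s])
        fix j t
        assume j: "j \<in> {1..n}" and t: "t \<in> {s n (j - 1)..s n j}"
        have "m \<le> s n (j - 1)" "s n j \<le> M"
          using partition_mono[of n "s n" 0 "j - 1"] partition_mono[of n "s n" j n] s j by auto
        then have "dist (f (l n j)) (f t) < r / 2"
          using fine[OF j] t N[of n] n by (intro d(2)) (auto simp: dist_real_def)
        then show "\<bar>f (l n j) - f t\<bar> \<le> r / 2"
          by (simp add: dist_real_def)
      qed (use \<open>0 < r\<close> in auto)
      then show "norm ((\<Sum>j=1..n. f (l n j) *\<^sub>R E {s n (j - 1)<..s n j}) -
        multiplication_map m M E f) < r"
        using \<open>0 < r\<close> by linarith
    qed
  qed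
qed

text \<open>The predicate quantifies over all admissible sequences of partitions and determines a
  limit only if there is one. Equal partitions tagged at right endpoints provide it, thanks to
  \<open>m < M\<close>.\<close>

lemma has_spectral_integral_unique:
  assumes "has_spectral_integral m M E f T" "has_spectral_integral m M E f T'"
  shows "T = T'"
proof -
  define s :: "nat \<Rightarrow> nat \<Rightarrow> real" where "s n j = m + (M - m) * j / n" for n j
  \<comment> \<open>The summand 1 makes the mesh \<open>(M - m) / n\<close> strictly smaller than
    \<open>\<epsilon> n\<close>.\<close>
  define \<epsilon> :: "nat \<Rightarrow> real" where "\<epsilon> n = (M - m + 1) / n" for n
  have "\<epsilon> \<longlonglongrightarrow> 0"
    unfolding \<epsilon>_def by (rule lim_const_over_n)
  moreover have "s n 0 = m \<and> s n n = M" if "n \<ge> 1" for n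
    using that by (simp add: s_def)
  moreover have "s n (j - 1) < s n j \<and> s n j - s n (j - 1) < \<epsilon> n \<and>
      s n j \<in> {s n (j - 1)<..s n j}" if "n \<ge> 1" "j \<in> {1..n}" for n j
  proof -
    have "s n j - s n (j - 1) = (M - m) / n"
      using that by (simp add: s_def field_simps)
    moreover have "0 < (M - m) / n" "(M - m) / n < (M - m + 1) / n"
      using that less by (auto intro!: divide_strict_right_mono)
    ultimately show ?thesis
      by (auto simp: \<epsilon>_def)
  qed
  ultimately have *: "\<epsilon> \<longlonglongrightarrow> 0 \<and> (\<forall>n\<ge>1. s n 0 = m \<and> s n n = M \<and>
        (\<forall>j\<in>{1..n}. s n (j - 1) < s n j \<and> s n j - s n (j - 1) < \<epsilon> n \<and>
          s n j \<in> {s n (j - 1)<..s n j}))"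
    by blast
  show ?thesis
    by (rule LIMSEQ_unique)
      (use assms[unfolded has_spectral_integral_def, rule_format, OF *] in auto)
qed

lemma spectral_integral_eq:
  "continuous_on {m..M} f \<Longrightarrow> spectral_integral m M E f = multiplication_map m M E f"
  unfolding spectral_integral_def
  using has_spectral_integral_multiplication_map has_spectral_integral_unique by blast

section \<open>The integrals form a subspace\<close>

lemma spectral_operators_eq:
  "spectral_operators m M E = multiplication_map m M E ` {f. continuous_on {m..M} f}"
  unfolding spectral_operators_def by (intro image_cong) (auto simp: spectral_integral_eq)

lemma subspace_spectral_operators: "subspace (spectral_operators m M E)"
  unfolding spectral_operators_eq subspace_def
proof (intro conjI ballI allI)
  have "multiplication_map m M E (\<lambda>_. 0) = 0"
    by (intro bmap_eqI) (simp add: apply_multiplication_map apply_zero)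
  then show "0 \<in> multiplication_map m M E ` {f. continuous_on {m..M} f}"
    by (intro image_eqI[of _ _ "\<lambda>_. 0"]) auto
next
  fix F G
  assume "F \<in> multiplication_map m M E ` {f. continuous_on {m..M} f}"
    "G \<in> multiplication_map m M E ` {f. continuous_on {m..M} f}"
  then obtain f g where fg: "continuous_on {m..M} f" "continuous_on {m..M} g"
    "F = multiplication_map m M E f" "G = multiplication_map m M E g"
    by blast
  then have "F + G = multiplication_map m M E (\<lambda>t. f t + g t)"
    by (intro bmap_eqI)
      (simp add: apply_plus apply_multiplication_map continuous_on_add scaleR_left_distrib)
  then show "F + G \<in> multiplication_map m M E ` {f. continuous_on {m..M} f}"
    using fg by (intro image_eqI[of _ _ "\<lambda>t. f t + g t"]) (auto intro: continuous_on_add)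
next
  fix c F
  assume "F \<in> multiplication_map m M E ` {f. continuous_on {m..M} f}"
  then obtain f where f: "continuous_on {m..M} f" "F = multiplication_map m M E f"
    by blast
  then have "c *\<^sub>R F = multiplication_map m M E (\<lambda>t. c * f t)"
    by (intro bmap_eqI) (simp add: apply_scaleR apply_multiplication_map continuous_on_mult_left)
  then show "c *\<^sub>R F \<in> multiplication_map m M E ` {f. continuous_on {m..M} f}"
    using f by (intro image_eqI[of _ _ "\<lambda>t. c * f t"]) (auto intro: continuous_on_mult_left)
qed

section \<open>Isometry and completeness\<close>

lemma abs_le_norm_multiplication_map:
  assumes f: "continuous_on {m..M} f"
    and separating: "\<And>lo hi. lo \<in> {m<..M} \<Longrightarrow> hi \<in> {m<..M} \<Longrightarrow> lo < hi \<Longrightarrow>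
      E {m<..hi} - E {m<..lo} \<noteq> 0"
    and t: "t \<in> {m..M}"
  shows "\<bar>f t\<bar> \<le> norm (multiplication_map m M E f)"
proof (rule field_le_epsilon)
  fix e :: real
  assume "0 < e"
  then obtain d where d: "d > 0" "\<And>u. u \<in> {m..M} \<Longrightarrow> dist u t < d \<Longrightarrow> dist (f u) (f t) < e"
    using f t unfolding continuous_on_iff by metis
  \<comment> \<open>Since \<open>t\<close> may be an endpoint of \<open>[m, M]\<close>, the
    neighbourhood of \<open>t\<close> is cut down to \<open>(m, M)\<close>, where
    \<open>separating\<close> applies to any \<open>lo < hi\<close>.\<close>
  have "max m (t - d) < min M (t + d)"
    using d(1) t less by auto
  then obtain lo where lo: "max m (t - d) < lo" "lo < min M (t + d)"
    using dense by blast
  then obtain hi where hi: "lo < hi" "hi < min M (t + d)"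
    using dense by blast
  have "E {lo<..hi} \<noteq> 0"
    using separating[of lo hi] lo hi by (simp add: E_Ioc_eq_diff[of lo hi])
  then obtain x where x: "bmap_apply (E {lo<..hi}) x \<noteq> 0"
    by (metis bmap_eqI apply_zero)
  then have "x \<noteq> 0"
    using apply_E_at_zero[of lo hi] lo hi by auto
  \<comment> \<open>A nonzero vector with threshold within \<open>d\<close> of \<open>t\<close> is
    found, and the operator scales it by nearly \<open>f t\<close>.\<close>
  have "\<mu> x \<in> {lo..hi}"
    using x lo hi by (intro threshold_mem_Icc) auto
  then have "dist (f (\<mu> x)) (f t) < e"
    using threshold_mem[of x] lo hi by (intro d(2)) (auto simp: dist_real_def)
  moreover have "\<bar>f (\<mu> x)\<bar> \<le> norm (multiplication_map m M E f)"
    using norm_bmap_bound[OF \<open>x \<noteq> 0\<close>, of "multiplication_map m M E f"] \<open>x \<noteq> 0\<close> f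
    by (simp add: apply_multiplication_map)
  ultimately show "\<bar>f t\<bar> \<le> norm (multiplication_map m M E f) + e"
    by (simp add: dist_real_def)
qed

lemma complete_spectral_operators:
  assumes separating: "\<And>lo hi. lo \<in> {m<..M} \<Longrightarrow> hi \<in> {m<..M} \<Longrightarrow> lo < hi \<Longrightarrow>
      E {m<..hi} - E {m<..lo} \<noteq> 0"
  shows "complete (spectral_operators m M E)"
  unfolding complete_def
proof (intro allI impI, elim conjE)
  fix T :: "nat \<Rightarrow> 'a bmap"
  assume "\<forall>n. T n \<in> spectral_operators m M E" and Cauchy: "Cauchy T"
  then have "\<forall>n. \<exists>f. continuous_on {m..M} f \<and> T n = multiplication_map m M E f"
    unfolding spectral_operators_eq by blast
  then obtain f where f: "\<And>n. continuous_on {m..M} (f n)"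
    "\<And>n. T n = multiplication_map m M E (f n)"
    by metis
  \<comment> \<open>The lower norm bound, applied to a difference of integrands, turns a Cauchy
    sequence of operators into a uniformly Cauchy sequence of functions.\<close>
  have dist_le: "dist (f i t) (f j t) \<le> dist (T i) (T j)" if "t \<in> {m..M}" for i j t
    using abs_le_norm_multiplication_map[OF _ separating that, of "\<lambda>t. f i t - f j t"] f
    by (simp add: dist_norm multiplication_map_diff continuous_on_diff)
  have "uniformly_Cauchy_on {m..M} f"
  proof (rule uniformly_Cauchy_onI)
    fix e :: real
    assume "0 < e"
    then obtain N where "\<forall>i\<ge>N. \<forall>j\<ge>N. dist (T i) (T j) < e"
      using Cauchy unfolding Cauchy_def by blast
    then show "\<exists>N. \<forall>t\<in>{m..M}. \<forall>i\<ge>N. \<forall>j\<ge>N. dist (f i t) (f j t) < e"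
      using dist_le order.strict_trans1 by blast
  qed
  then obtain g where g: "uniform_limit {m..M} f g sequentially"
    using Cauchy_uniformly_convergent uniformly_convergent_on_def by blast
  have g_cont: "continuous_on {m..M} g"
    by (rule uniform_limit_theorem[OF _ g]) (use f in auto)
  have "T \<longlonglongrightarrow> multiplication_map m M E g"
  proof (rule metric_LIMSEQ_I)
    fix e :: real
    assume "0 < e"
    then obtain N where N: "\<And>n t. n \<ge> N \<Longrightarrow> t \<in> {m..M} \<Longrightarrow> dist (f n t) (g t) < e / 2"
      using uniform_limitD[OF g, of "e / 2"] \<open>0 < e\<close> unfolding eventually_sequentially
      by (metis half_gt_zero)
    show "\<exists>N. \<forall>n\<ge>N. dist (T n) (multiplication_map m M E g) < e"
    proof (intro exI allI impI)
      fix n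
      assume "n \<ge> N"
      \<comment> \<open>The upper norm bound carries uniform convergence back to
        \<open>B(X)\<close>; as it is not strict, \<open>e / 2\<close> is used.\<close>
      have "norm (multiplication_map m M E (\<lambda>t. f n t - g t)) \<le> e / 2"
        using N[OF \<open>n \<ge> N\<close>] f g_cont
        by (intro norm_multiplication_map_le continuous_on_diff)
          (auto simp: dist_real_def less_imp_le)
      then show "dist (T n) (multiplication_map m M E g) < e"
        using \<open>0 < e\<close> f g_cont by (simp add: dist_norm multiplication_map_diff)
    qed
  qed
  then show "\<exists>F\<in>spectral_operators m M E. T \<longlonglongrightarrow> F"
    using g_cont unfolding spectral_operators_eq by blast
qed

end

theorem theorem4p14:
  fixes smul :: "'k::real_normed_field \<Rightarrow> 'a::banach \<Rightarrow> 'a"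
    and E :: "real set \<Rightarrow> 'a bmap"
    and m M :: real
  assumes "normed_space_over smul"
    and "\<exists>x::'a. x \<noteq> 0"
    and "spectral_projection m M E"
  shows "subspace (spectral_operators m M E) \<and>
    ((\<forall>lo\<in>{m<..M}. \<forall>hi\<in>{m<..M}. lo < hi \<longrightarrow> E {m<..hi} - E {m<..lo} \<noteq> 0)
      \<longrightarrow> complete (spectral_operators m M E))"
proof -
  interpret nontrivial_spectral_projection m M E
    using assms by unfold_locales
  show ?thesis
    using subspace_spectral_operators complete_spectral_operators by blast
qed

end
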